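(* Let $h\in\mathbb{Z}[X]$ and let $(a_n)_{n\in\mathbb{N}}$ be the sequence of $h$-Schenker sums, $a_n=\sum_{j=0}^n\frac{n!}{j!}h(n)^j$. If $p$ is a prime number and $n$ is a nonnegative integer such that $p\mid h(n)$, then $v_p(a_n)=v_p(n!)=\frac{n-s_p(n)}{p-1}$.
   Context: $\mathbb{N}=\{0,1,2,\dots\}$ and $0^0=1$. $v_p$ is the $p$-adic valuation and $s_p(n)$ is the sum of the digits of $n$ in base $p$. *)

theory Defs
  imports
    "HOL-Computational_Algebra.Computational_Algebra"
    "HOL-Library.Extended_Real"
begin

(* The division is exact, since fact j divides fact n for j <= n; 0 ^ 0 = 1. *)
definition schenker_sum :: "int poly \<Rightarrow> nat \<Rightarrow> int" where
  "schenker_sum h n = (\<Sum>j\<le>n. (fact n div fact j) * poly h (int n) ^ j)"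

(* The library sets multiplicity p 0 = 0, whereas the valuation of 0 is infinite;
   hence the extended codomain. *)
definition padic_val :: "nat \<Rightarrow> int \<Rightarrow> ereal" where
  "padic_val p x = (if x = 0 then \<infinity> else ereal (real (multiplicity (int p) x)))"

(* The i-th base-b digit of n is (n div b ^ i) mod b. For b >= 2 it vanishes when i > n,
   as n < b ^ n, so the sum runs over all digits. *)
definition digit_sum :: "nat \<Rightarrow> nat \<Rightarrow> nat" where
  "digit_sum b n = (\<Sum>i\<le>n. (n div b ^ i) mod b)"

end

theory Submission
  imports Defs
begin

text \<open>
  Passing from \<open>n\<close> to \<open>n + 1\<close> turns the \<open>v\<close> trailing digits \<open>p - 1\<close> into zeros and
  increments the next one, where \<open>v\<close> is the valuation of \<open>n + 1\<close>. Summing the resulting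
  change of the digit sum gives Legendre's formula. As the digit sum of \<open>j > 0\<close> is positive,
  the valuation of \<open>j!\<close> is less than \<open>j\<close>, hence every term with \<open>j > 0\<close> of the Schenker sum
  has larger valuation than the term \<open>n!\<close> for \<open>j = 0\<close>.
\<close>

text \<open>The summation limit in \<open>digit_sum\<close> depends on the argument; freeing it lets
  the sums for \<open>n\<close> and \<open>n div b\<close> be matched after an index shift.\<close>

lemma digit_sum_extend:
  assumes "b \<ge> 2" "n \<le> m"
  shows "digit_sum b n = (\<Sum>i\<le>m. (n div b ^ i) mod b)"
  unfolding digit_sum_def
proof (rule sum.mono_neutral_left)
  show "\<forall>i\<in>{..m} - {..n}. (n div b ^ i) mod b = 0"
  proof
    fix i assume "i \<in> {..m} - {..n}"
    then have "n < i" by simp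
    also have "i < 2 ^ i" by simp
    also have "(2::nat) ^ i \<le> b ^ i" using assms by (intro power_mono) auto
    finally show "(n div b ^ i) mod b = 0" by simp
  qed
qed (use assms in auto)

lemma digit_sum_rec:
  assumes "b \<ge> 2"
  shows "digit_sum b n = n mod b + digit_sum b (n div b)"
proof -
  have "digit_sum b n = (\<Sum>i\<le>Suc n. (n div b ^ i) mod b)"
    using assms by (intro digit_sum_extend) auto
  also have "\<dots> = n mod b + (\<Sum>i\<le>n. ((n div b) div b ^ i) mod b)"
    by (subst sum.atMost_Suc_shift) (simp add: div_mult2_eq)
  also have "(\<Sum>i\<le>n. ((n div b) div b ^ i) mod b) = digit_sum b (n div b)"
    using assms by (intro digit_sum_extend [symmetric]) auto
  finally show ?thesis .
qed

lemma digit_sum_mult_add: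
  assumes "b \<ge> 2" "r < b"
  shows "digit_sum b (b * q + r) = r + digit_sum b q"
  using digit_sum_rec [of b "b * q + r"] assms by simp

lemma digit_sum_0 [simp]: "digit_sum b 0 = 0"
  by (simp add: digit_sum_def)

text \<open>The additive form avoids truncated subtraction, since carries may make the digit sum
  drop.\<close>

lemma digit_sum_Suc:
  assumes "prime p"
  shows "(p - 1) * multiplicity (int p) (int (Suc n)) + digit_sum p (Suc n) = Suc (digit_sum p n)"
proof (induction n rule: less_induct)
  case (less n)
  have p: "p \<ge> 2" using assms prime_ge_2_nat by blast
  define q r where "q = Suc n div p" and "r = Suc n mod p"
  have n: "Suc n = p * q + r" and r: "r < p" using p by (auto simp: q_def r_def)
  show ?case
  proof (cases r)
    case 0
    with n obtain m where m: "q = Suc m" by (cases q) auto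
    then have "q > 0" by simp
    \<comment> \<open>As \<open>Suc n\<close> ends in the digit 0, \<open>n\<close> ends in
      \<open>p - 1\<close> and its quotient \<open>m\<close> is the predecessor of \<open>q\<close>.
      The induction hypothesis for \<open>m\<close> covers the higher digits; the lost digit
      \<open>p - 1\<close> is balanced by the one extra factor \<open>p\<close> of
      \<open>Suc n\<close>.\<close>
    have eq: "n = p * m + (p - 1)" using n 0 m p by simp
    have "m * 1 \<le> p * m" using p by simp
    then have "m < n" using eq p by linarith
    note IH = less [OF this]
    have "multiplicity (int p) (int (Suc n)) = Suc (multiplicity (int p) (int q))"
      using n 0 p \<open>q > 0\<close> multiplicity_times_same [where p = "int p" and x = "int q"]
      by (simp del: of_nat_Suc)
    moreover have "digit_sum p (Suc n) = digit_sum p q"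
      using digit_sum_mult_add [of p 0 q] n 0 p by simp
    moreover have "digit_sum p n = p - 1 + digit_sum p m"
      using digit_sum_mult_add [of p "p - 1" m] eq p by simp
    ultimately show ?thesis using IH m by simp
  next
    case (Suc s)
    have "\<not> p dvd Suc n" using Suc by (simp add: r_def dvd_eq_mod_eq_0)
    then have "multiplicity (int p) (int (Suc n)) = 0"
      by (intro not_dvd_imp_multiplicity_0) (simp only: of_nat_dvd_iff not_False_eq_True)
    moreover have "digit_sum p (Suc n) = r + digit_sum p q"
      using digit_sum_mult_add n r p by simp
    \<comment> \<open>No carry occurs: \<open>n\<close> and \<open>Suc n\<close> share the quotient
      \<open>q\<close>, and only the last digit changes.\<close>
    moreover have "digit_sum p n = s + digit_sum p q"
      using digit_sum_mult_add [of p s q] n r p Suc by simp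
    ultimately show ?thesis using Suc by simp
  qed
qed

lemma legendre_digit_sum:
  assumes "prime p"
  shows "(p - 1) * multiplicity (int p) (fact n) + digit_sum p n = n"
proof (induction n)
  case (Suc n)
  have "multiplicity (int p) (fact (Suc n)) =
      multiplicity (int p) (int (Suc n)) + multiplicity (int p) (fact n)"
    unfolding fact_Suc of_nat_id using assms
    by (intro prime_elem_multiplicity_mult_distrib) auto
  then show ?case using Suc digit_sum_Suc [OF assms, of n] by (simp add: algebra_simps)
qed simp

lemma digit_sum_pos:
  assumes "b \<ge> 2" "n > 0"
  shows "digit_sum b n > 0"
  using assms(2)
proof (induction n rule: less_induct)
  case (less n)
  then show ?case
    using digit_sum_rec [OF assms(1), of n] assms(1) less.IH [of "n div b"]
    by (cases "n < b") (auto simp: div_greater_zero_iff)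
qed

lemma multiplicity_fact_less:
  assumes "prime p" "j > 0"
  shows "multiplicity (int p) (fact j) < j"
proof -
  have p: "p \<ge> 2" using assms prime_ge_2_nat by blast
  then have "1 * multiplicity (int p) (fact j) \<le> (p - 1) * multiplicity (int p) (fact j)"
    by (intro mult_right_mono) auto
  then show ?thesis
    using legendre_digit_sum [OF assms(1), of j] digit_sum_pos [OF p assms(2)] by linarith
qed

text \<open>This is the equality case of the ultrametric inequality. Divisibility of
  \<open>y\<close> replaces a comparison of multiplicities because it also covers
  \<open>y = 0\<close>, where \<open>multiplicity\<close> is 0 by convention, and because it passes
  to sums of several terms.\<close>

lemma multiplicity_add_eq:
  assumes "x \<noteq> 0" "\<not> is_unit p" "p ^ Suc (multiplicity p x) dvd y"
  shows "multiplicity p (x + y) = multiplicity p (x :: 'a :: factorial_semiring_multiplicative)"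
proof (cases "y = 0")
  case False
  then have "multiplicity p x < multiplicity p y"
    using assms(2,3) power_dvd_iff_le_multiplicity [of y p] by (simp add: Suc_le_eq del: power_Suc)
  then show ?thesis
    using assms(1) False by (rule multiplicity_sum_lt)
qed simp

theorem theorem15:
  fixes h :: "int poly" and p n :: nat
  assumes "prime p"
    and "int p dvd poly h (int n)"
  shows "padic_val p (schenker_sum h n) = padic_val p (fact n) \<and>
         padic_val p (fact n) = ereal ((real n - real (digit_sum p n)) / (real p - 1))"
proof -
  have p: "p \<ge> 2" using assms prime_ge_2_nat by blast
  let ?v = "multiplicity (int p)"
  let ?t = "\<lambda>j. (fact n div fact j) * poly h (int n) ^ j"
  have dvd: "int p ^ Suc (?v (fact n)) dvd ?t j" if "j \<in> {..n} - {0}" for j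
  proof -
    define q :: int where "q = fact n div fact j"
    have q: "fact n = fact j * q" using that by (simp add: q_def fact_dvd)
    then have "q \<noteq> 0" by auto
    then have "?v (fact n) = ?v (fact j) + ?v q"
      unfolding q using assms by (intro prime_elem_multiplicity_mult_distrib) auto
    moreover have "?v (fact j) < j" using assms that by (intro multiplicity_fact_less) auto
    \<comment> \<open>Replacing \<open>?v (fact j)\<close> by the strictly larger \<open>j\<close>
      gains the extra factor \<open>p\<close>; the exponent \<open>j\<close> comes from the power of
      \<open>poly h (int n)\<close>.\<close>
    ultimately have "int p ^ Suc (?v (fact n)) dvd int p ^ (?v q + j)"
      by (intro le_imp_power_dvd) simp
    also have "\<dots> dvd q * poly h (int n) ^ j"
      unfolding power_add using assms by (intro mult_dvd_mono multiplicity_dvd dvd_power_same)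
    finally show ?thesis by (simp add: q_def)
  qed
  have sum: "schenker_sum h n = fact n + (\<Sum>j\<in>{..n} - {0}. ?t j)"
    unfolding schenker_sum_def by (subst sum.remove [of _ 0]) auto
  have rest: "int p ^ Suc (?v (fact n)) dvd (\<Sum>j\<in>{..n} - {0}. ?t j)"
    using dvd by (intro dvd_sum)
  \<comment> \<open>If the whole sum were 0, this power would divide it and the rest, hence also
    \<open>fact n\<close>. Excluding 0 keeps \<open>padic_val\<close> finite.\<close>
  have "\<not> int p ^ Suc (?v (fact n)) dvd fact n"
    using p by (subst power_dvd_iff_le_multiplicity) auto
  with rest have "schenker_sum h n \<noteq> 0"
    unfolding sum using dvd_add_left_iff dvd_0_right by metis
  moreover have "?v (schenker_sum h n) = ?v (fact n)"
    unfolding sum using rest p by (intro multiplicity_add_eq) auto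
  moreover have "real (?v (fact n)) = (real n - real (digit_sum p n)) / (real p - 1)"
  proof -
    have "(real p - 1) * real (?v (fact n)) + real (digit_sum p n) = real n"
      using arg_cong [OF legendre_digit_sum [OF assms(1), of n], of real] p
      by (simp add: of_nat_diff)
    then show ?thesis using p by (simp add: field_simps)
  qed
  ultimately show ?thesis by (simp add: padic_val_def)
qed

end
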